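(* Let $a,b>0$ be real numbers and $0\le p\le 1$. (i) If either ($1/2\le p\le 1$ and $a\ge b$) or ($0\le p\le 1/2$ and $a\le b$), then $d_p(a,b)\ge d_{1-p}(a,b)$. (ii) If either ($0\le p\le 1/2$ and $a\ge b$) or ($1/2\le p\le 1$ and $a\le b$), then $d_p(a,b)\le d_{1-p}(a,b)$.
   Context: For real $a,b>0$ and $0\le p\le 1$, $d_p(a,b):=pa+(1-p)b-a^pb^{1-p}$. *)

theory Defs
  imports Complex_Main
begin

(* Difference of the p-weighted arithmetic and geometric means; only meaningful for
   a, b > 0, where powr is the usual real power (in particular a powr 0 = 1). *)
definition d :: "real \<Rightarrow> real \<Rightarrow> real \<Rightarrow> real" where
  "d p a b = p * a + (1 - p) * b - a powr p * b powr (1 - p)"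

end

theory Submission
  imports Defs
begin

text \<open>Put \<open>a = g * exp t\<close> and \<open>b = g * exp (-t)\<close>, where \<open>g\<close> is the geometric mean of \<open>a\<close> and \<open>b\<close>,
  and let \<open>s = 2 * p - 1\<close>. Then \<open>a powr p * b powr (1 - p) = g * exp (s * t)\<close>, so that
  \<open>d p a b - d (1 - p) a b = 2 * g * (s * sinh t - sinh (s * t))\<close>.
  For \<open>a \<ge> b\<close> and \<open>p \<ge> 1/2\<close> this gives \<open>t \<ge> 0\<close> and \<open>0 \<le> s \<le> 1\<close>, and the bracket is nonnegative because
  \<open>sinh\<close> is convex on the nonnegative half-line and vanishes at \<open>0\<close> (\<open>sinh_mult_le\<close>).
  The other three cases follow from this one by exchanging \<open>p\<close> with \<open>1 - p\<close>, \<open>a\<close> with \<open>b\<close>, or both,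
  because the double exchange leaves \<open>d\<close> unchanged (\<open>d_swap\<close>).\<close>

text \<open>Both sides agree at \<open>t = 0\<close>, and the derivative of their difference is
  \<open>s * (cosh t - cosh (s * t))\<close>, which is nonnegative since \<open>cosh\<close> is increasing for
  nonnegative arguments.\<close>
lemma sinh_mult_le:
  fixes s t :: real
  assumes s: "0 \<le> s" "s \<le> 1" and t: "0 \<le> t"
  shows "sinh (s * t) \<le> s * sinh t"
proof -
  let ?f = "\<lambda>x. s * sinh x - sinh (s * x)"
  have "?f 0 \<le> ?f t"
  proof (rule DERIV_nonneg_imp_nondecreasing[OF t])
    fix x :: real assume x: "0 \<le> x" "x \<le> t"
    have "(?f has_real_derivative s * (cosh x - cosh (s * x))) (at x)"
      by (auto intro!: derivative_eq_intros simp: algebra_simps)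
    moreover have "cosh (s * x) \<le> cosh x"
      using s x by (simp add: cosh_real_nonneg_le_iff mult_left_le_one_le)
    ultimately show "\<exists>y. (?f has_real_derivative y) (at x) \<and> 0 \<le> y"
      using s by (auto intro!: exI mult_nonneg_nonneg)
  qed
  then show ?thesis by simp
qed

lemma d_swap: "d (1 - p) b a = d p a b"
  by (simp add: d_def)

lemma d_diff_eq_sinh:
  fixes g t p :: real
  assumes g: "g > 0"
  defines "a \<equiv> g * exp t" and "b \<equiv> g * exp (- t)"
  shows "d p a b - d (1 - p) a b
         = 2 * g * ((2 * p - 1) * sinh t - sinh ((2 * p - 1) * t))"
proof -
  have powr: "a powr q * b powr (1 - q) = g * exp ((2 * q - 1) * t)" for q
  proof -
    have "a powr q * b powr (1 - q)
          = (g powr q * g powr (1 - q)) * (exp (q * t) * exp ((1 - q) * (- t)))"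
      using g by (simp add: a_def b_def powr_mult exp_powr_real mult_ac)
    also have "\<dots> = g * exp ((2 * q - 1) * t)"
      using g by (simp add: powr_add[symmetric] exp_add[symmetric] algebra_simps)
    finally show ?thesis .
  qed
  have "(2 * (1 - p) - 1) * t = - ((2 * p - 1) * t)"
    by (simp add: algebra_simps)
  then have powr': "a powr (1 - p) * b powr p = g * exp (- ((2 * p - 1) * t))"
    using powr[of "1 - p"] by simp
  have "d p a b - d (1 - p) a b = (2 * p - 1) * (a - b)
        - (a powr p * b powr (1 - p) - a powr (1 - p) * b powr p)"
    by (simp add: d_def algebra_simps)
  also have "\<dots> = 2 * g * ((2 * p - 1) * sinh t - sinh ((2 * p - 1) * t))"
    unfolding powr powr' by (simp add: a_def b_def sinh_def field_simps)
  finally show ?thesis .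
qed

lemma d_complement_le:
  fixes a b p :: real
  assumes b: "b > 0" and ab: "b \<le> a" and p: "1/2 \<le> p" "p \<le> 1"
  shows "d (1 - p) a b \<le> d p a b"
proof -
  define g t where "g = sqrt (a * b)" and "t = ln (a / b) / 2"
  have a: "a > 0" using b ab by simp
  have g: "g > 0" using a b by (simp add: g_def)
  have t: "t \<ge> 0" using b ab by (simp add: t_def)
  have exp_t: "exp t = sqrt (a / b)"
    using a b by (simp add: t_def powr_half_sqrt[symmetric] powr_def)
  have "a = g * exp t" "b = g * exp (- t)"
    using a b by (simp_all add: exp_t g_def exp_minus real_sqrt_mult real_sqrt_divide)
  then have "d p a b - d (1 - p) a b
             = 2 * g * ((2 * p - 1) * sinh t - sinh ((2 * p - 1) * t))"
    using d_diff_eq_sinh[OF g] by metis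
  also have "\<dots> \<ge> 0"
    using g p sinh_mult_le[OF _ _ t, of "2 * p - 1"] by simp
  finally show ?thesis by simp
qed

theorem theorem2p5:
  fixes a b p :: real
  assumes "a > 0" and "b > 0" and "0 \<le> p" and "p \<le> 1"
  shows "((1/2 \<le> p \<and> p \<le> 1 \<and> a \<ge> b) \<or> (0 \<le> p \<and> p \<le> 1/2 \<and> a \<le> b)
            \<longrightarrow> d p a b \<ge> d (1 - p) a b)
       \<and> ((0 \<le> p \<and> p \<le> 1/2 \<and> a \<ge> b) \<or> (1/2 \<le> p \<and> p \<le> 1 \<and> a \<le> b)
            \<longrightarrow> d p a b \<le> d (1 - p) a b)"
  using assms d_complement_le[of b a p] d_complement_le[of b a "1 - p"]
    d_complement_le[of a b p] d_complement_le[of a b "1 - p"]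
    d_swap[of p a b] d_swap[of p b a]
  by auto

end
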